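(* Let $x(\xi,\eta,\tau)$, $y(\xi,\eta,\tau)$, $t(\tau)$ be the polynomial coordinate map of a curvilinear space-time element in the space-time slab setting described in the context, with non-singular Jacobian matrix. Suppose that the geometric features of the element are completely represented by polynomials in the numerical scheme, i.e. $x,y,t$ are polynomials and all the metric terms $|J|\tau_*, |J|\xi_*, |J|\eta_*$ ($*\in\{t,x,y\}$) belong to the polynomial space $V$ of the scheme. Then the geometric conservation law is satisfied numerically: for each $*\in\{t,x,y\}$, $$\frac{\partial}{\partial\tau}\, I_V\big(|J|\tau_*\big)+\frac{\partial}{\partial\xi}\, I_V\big(|J|\xi_*\big)+\frac{\partial}{\partial\eta}\, I_V\big(|J|\eta_*\big)=0$$ identically on $[-1,1]^3$.
   Context: Reference coordinates are $(\tau,\xi,\eta)\in[-1,1]^3$, physical coordinates are $(t,x,y)$. The element geometry is given by $$x=\sum_{i_1,i_2,i_3}\phi_{i_1}(\xi)\phi_{i_2}(\eta)\phi_{i_3}(\tau)\,x_{i_1,i_2,i_3},\quad y=\sum_{i_1,i_2,i_3}\phi_{i_1}(\xi)\phi_{i_2}(\eta)\phi_{i_3}(\tau)\,y_{i_1,i_2,i_3},\quad t=t(\tau)=\sum_{i_3}\phi_{i_3}(\tau)\,t_{i_3},$$ where the $\phi_i$ are 1D Lagrange polynomials on $[-1,1]$ (full Lagrange bases; the polynomial degree in $\tau$ may differ from that in $\xi,\eta$). The space-time slab setting means that $t$ depends on $\tau$ only, so $t_\xi=t_\eta=0$. $J=\partial(t,x,y)/\partial(\tau,\xi,\eta)$ is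 the Jacobian matrix, assumed non-singular, and $|J|$ is its determinant. Subscripts denote partial derivatives; $\tau_t,\tau_x,\dots,\eta_y$ are the entries of $J^{-1}=\partial(\tau,\xi,\eta)/\partial(t,x,y)$. The metric terms are $$|J|\tau_t=x_\xi y_\eta-x_\eta y_\xi,\quad |J|\tau_x=|J|\tau_y=0,$$ $$|J|\xi_t=-x_\tau y_\eta+y_\tau x_\eta,\quad |J|\xi_x=t_\tau y_\eta,\quad |J|\xi_y=-t_\tau x_\eta,$$ $$|J|\eta_t=x_\tau y_\xi-y_\tau x_\xi,\quad |J|\eta_x=-t_\tau y_\xi,\quad |J|\eta_y=t_\tau x_\xi.$$ The geometric conservation law (GCL) is $\partial_\tau(|J|\tau_* )+\partial_\xi(|J|\xi_* )+\partial_\eta(|J|\eta_* )=0$ for $*=t,x,y$. The numerical scheme works with a tensor-product polynomial space $V=P^a(\xi)\otimes P^b(\eta)\otimes P^c(\tau)$ (polynomials of degree at most $a,b,c$ in $\xi,\eta,\tau$, respectively) and a tensor grid of $(a+1)(b+1)(c+1)$ solution points; $I_V$ denotes Lagrange interpolation in $V$ at these points, and the scheme differentiates functions by differentiating their interpolants. Exact arithmetic is assumed (round-off is neglected). *)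

theory Defs
  imports "HOL-Analysis.Analysis"
begin

text \<open>
  A reference point is \<open>p = (\<tau>, \<xi>, \<eta>)\<close>, so that \<open>p $ 1\<close>, \<open>p $ 2\<close>, \<open>p $ 3\<close> are \<open>\<tau>\<close>, \<open>\<xi>\<close>, \<open>\<eta>\<close>;
  a physical point is \<open>(t, x, y)\<close>, with components 1, 2, 3 in that order.
\<close>

abbreviation reference_element :: "(real^3) set" where
  "reference_element \<equiv> cbox (- 1) 1"

definition lagrange_basis :: "nat \<Rightarrow> (nat \<Rightarrow> real) \<Rightarrow> nat \<Rightarrow> real \<Rightarrow> real" where
  "lagrange_basis n u i z = (\<Prod>j\<in>{..n} - {i}. (z - u j) / (u i - u j))"

definition lagrange_nodes :: "nat \<Rightarrow> (nat \<Rightarrow> real) \<Rightarrow> bool" where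
  "lagrange_nodes n u \<longleftrightarrow> inj_on u {..n} \<and> u ` {..n} \<subseteq> {-1..1}"

text \<open>The same basis (degree \<open>n\<close>, nodes \<open>u\<close>) is used in \<open>\<xi>\<close> and \<open>\<eta>\<close>; the one in \<open>\<tau>\<close> is independent of it.\<close>

definition space_coordinate ::
    "nat \<Rightarrow> (nat \<Rightarrow> real) \<Rightarrow> nat \<Rightarrow> (nat \<Rightarrow> real) \<Rightarrow> (nat \<Rightarrow> nat \<Rightarrow> nat \<Rightarrow> real) \<Rightarrow> real^3 \<Rightarrow> real" where
  "space_coordinate n u m v X p =
    (\<Sum>i1\<le>n. \<Sum>i2\<le>n. \<Sum>i3\<le>m.
      lagrange_basis n u i1 (p $ 2) * lagrange_basis n u i2 (p $ 3) * lagrange_basis m v i3 (p $ 1)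
        * X i1 i2 i3)"

definition time_coordinate ::
    "nat \<Rightarrow> (nat \<Rightarrow> real) \<Rightarrow> (nat \<Rightarrow> real) \<Rightarrow> real \<Rightarrow> real" where
  "time_coordinate m v T \<tau> = (\<Sum>i3\<le>m. lagrange_basis m v i3 \<tau> * T i3)"

definition slab_map :: "(real \<Rightarrow> real) \<Rightarrow> (real^3 \<Rightarrow> real) \<Rightarrow> (real^3 \<Rightarrow> real) \<Rightarrow> real^3 \<Rightarrow> real^3" where
  "slab_map t x y p = vector [t (p $ 1), x p, y p]"

text \<open>
  \<open>metric_term F k j\<close> is \<open>|J|\<close> times the derivative of the \<open>k\<close>-th reference coordinate with respect
  to the \<open>j\<close>-th physical one; e.g. \<open>metric_term F 2 1\<close> is \<open>|J| \<xi>\<^sub>t\<close>. It is meaningful where \<open>J\<close> is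
  invertible, and the lemma below recovers the usual cross-product formulas for slab maps.
\<close>

definition metric_term :: "(real^3 \<Rightarrow> real^3) \<Rightarrow> 3 \<Rightarrow> 3 \<Rightarrow> real^3 \<Rightarrow> real" where
  "metric_term F k j p =
    det (jacobian F (at p)) * matrix_inv (jacobian F (at p)) $ k $ j"

definition partial :: "3 \<Rightarrow> (real^3 \<Rightarrow> real) \<Rightarrow> real^3 \<Rightarrow> real" where
  "partial k f p = deriv (\<lambda>s. f (\<chi> i. if i = k then s else p $ i)) (p $ k)"

text \<open>
  Membership only constrains the values on the reference element: metric terms are not meaningful
  outside it, where \<open>J\<close> may be singular.
\<close>

definition tensor_poly_space :: "nat \<Rightarrow> nat \<Rightarrow> nat \<Rightarrow> (real^3 \<Rightarrow> real) set" where
  "tensor_poly_space a b c =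
    {f. \<exists>\<alpha>. \<forall>p\<in>reference_element.
      f p = (\<Sum>i\<le>a. \<Sum>j\<le>b. \<Sum>k\<le>c. \<alpha> i j k * (p $ 2) ^ i * (p $ 3) ^ j * (p $ 1) ^ k)}"

text \<open>Lagrange interpolation on the grid of points \<open>\<xi> = r i\<close>, \<open>\<eta> = s j\<close>, \<open>\<tau> = q k\<close>.\<close>

definition tensor_interp ::
    "nat \<Rightarrow> (nat \<Rightarrow> real) \<Rightarrow> nat \<Rightarrow> (nat \<Rightarrow> real) \<Rightarrow> nat \<Rightarrow> (nat \<Rightarrow> real) \<Rightarrow> (real^3 \<Rightarrow> real) \<Rightarrow> real^3 \<Rightarrow> real" where
  "tensor_interp a r b s c q f p =
    (\<Sum>i\<le>a. \<Sum>j\<le>b. \<Sum>k\<le>c.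
      f (vector [q k, r i, s j]) *
        lagrange_basis a r i (p $ 2) * lagrange_basis b s j (p $ 3) * lagrange_basis c q k (p $ 1))"

lemma partial_eq_frechet:
  assumes "f differentiable (at p)"
  shows "partial k f p = frechet_derivative f (at p) (axis k 1)"
proof -
  let ?g = "\<lambda>s. (\<chi> i. if i = k then s else p $ i) :: real^3"
  have g: "?g = (\<lambda>s. p + (s - p $ k) *\<^sub>R axis k 1)"
    by (auto simp: fun_eq_iff vec_eq_iff axis_def)
  have dg: "(?g has_derivative (\<lambda>h. h *\<^sub>R axis k 1)) (at (p $ k))"
    unfolding g by (auto intro!: derivative_eq_intros)
  have gp: "?g (p $ k) = p" by (simp add: vec_eq_iff)
  have df: "(f has_derivative frechet_derivative f (at p)) (at (?g (p $ k)))"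
    using assms by (simp only: gp frechet_derivative_works)
  interpret F: linear "frechet_derivative f (at p)"
    by (rule linear_frechet_derivative[OF assms])
  have "((\<lambda>s. f (?g s)) has_derivative (\<lambda>h. frechet_derivative f (at p) (h *\<^sub>R axis k 1)))
      (at (p $ k))"
    by (rule has_derivative_compose[OF dg df])
  then have "((\<lambda>s. f (?g s)) has_field_derivative frechet_derivative f (at p) (axis k 1)) (at (p $ k))"
    by (simp add: has_field_derivative_def F.scaleR fun_eq_iff mult.commute has_derivative_eq_rhs)
  then show ?thesis
    unfolding partial_def by (rule DERIV_imp_deriv)
qed

lemma metric_term_slab_map:
  fixes x y :: "real^3 \<Rightarrow> real"
  assumes "t differentiable (at (p $ 1))" "x differentiable (at p)" "y differentiable (at p)"
    and inv: "invertible (jacobian (slab_map t x y) (at p))"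
  shows "metric_term (slab_map t x y) 1 1 p = partial 2 x p * partial 3 y p - partial 3 x p * partial 2 y p"
    and "metric_term (slab_map t x y) 1 2 p = 0"
    and "metric_term (slab_map t x y) 1 3 p = 0"
    and "metric_term (slab_map t x y) 2 1 p = - partial 1 x p * partial 3 y p + partial 1 y p * partial 3 x p"
    and "metric_term (slab_map t x y) 2 2 p = deriv t (p $ 1) * partial 3 y p"
    and "metric_term (slab_map t x y) 2 3 p = - deriv t (p $ 1) * partial 3 x p"
    and "metric_term (slab_map t x y) 3 1 p = partial 1 x p * partial 2 y p - partial 1 y p * partial 2 x p"
    and "metric_term (slab_map t x y) 3 2 p = - deriv t (p $ 1) * partial 2 y p"
    and "metric_term (slab_map t x y) 3 3 p = deriv t (p $ 1) * partial 2 x p"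
proof -
  let ?F = "slab_map t x y" and ?J = "jacobian (slab_map t x y) (at p)"
  let ?x = "frechet_derivative x (at p)" and ?y = "frechet_derivative y (at p)"
  define D where "D h = (vector [deriv t (p $ 1) * h $ 1, ?x h, ?y h] :: real^3)" for h :: "real^3"
  have t: "(t has_derivative (\<lambda>h. deriv t (p $ 1) * h)) (at (p $ 1))"
    using assms(1) by (metis DERIV_deriv_iff_real_differentiable has_field_derivative_def)
  have t': "((\<lambda>p. t (p $ 1)) has_derivative (\<lambda>h. deriv t (p $ 1) * h $ 1)) (at p)"
    by (rule has_derivative_compose[where f = "\<lambda>p. p $ 1" and g = t, OF _ t]) (rule bounded_linear_imp_has_derivative[OF bounded_linear_vec_nth])
  have x: "(x has_derivative ?x) (at p)" and y: "(y has_derivative ?y) (at p)"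
    using assms by (simp_all add: frechet_derivative_works)
  have "(?F has_derivative D) (at p)"
  proof (subst has_derivative_componentwise_within, intro ballI)
    fix b :: "real^3" assume "b \<in> Basis"
    then obtain i where b: "b = axis i 1" by (auto simp: Basis_vec_def)
    have "((\<lambda>x'. ?F x' $ i) has_derivative (\<lambda>h. D h $ i)) (at p)"
      using exhaust_3[of i] t' x y by (auto simp: slab_map_def D_def)
    then show "((\<lambda>x'. ?F x' \<bullet> b) has_derivative (\<lambda>h. D h \<bullet> b)) (at p)"
      by (simp add: b inner_axis)
  qed
  then have "D = frechet_derivative ?F (at p)" by (rule frechet_derivative_at)
  then have J: "?J $ i $ j = D (axis j 1) $ i" for i j
    by (simp add: jacobian_def matrix_def)
  have pt: "partial k x p = ?x (axis k 1)" "partial k y p = ?y (axis k 1)" for k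
    using assms by (simp_all add: partial_eq_frechet)
  have J': "?J $ 1 $ 1 = deriv t (p $ 1)" "?J $ 1 $ 2 = 0" "?J $ 1 $ 3 = 0"
    "?J $ 2 $ j = partial j x p" "?J $ 3 $ j = partial j y p" for j
    by (simp_all add: J D_def pt axis_def)
  define K where "K = (vector [
     vector [?J$2$2 * ?J$3$3 - ?J$2$3 * ?J$3$2, 0, 0],
     vector [?J$2$3 * ?J$3$1 - ?J$2$1 * ?J$3$3, ?J$1$1 * ?J$3$3, - ?J$1$1 * ?J$2$3],
     vector [?J$2$1 * ?J$3$2 - ?J$2$2 * ?J$3$1, - ?J$1$1 * ?J$3$2, ?J$1$1 * ?J$2$2]] :: real^3^3)"
  let ?I = "matrix_inv ?J"
  have I: "?J ** ?I = mat 1" "?I ** ?J = mat 1"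
    using inv unfolding invertible_def matrix_inv_def by (metis (mono_tags, lifting) someI_ex)+
  have "?J ** K = det ?J *\<^sub>R mat 1"
    by (simp add: vec_eq_iff forall_3 matrix_matrix_mult_def sum_3 K_def det_3 J' mat_def algebra_simps)
  then have "?I ** (?J ** K) = det ?J *\<^sub>R ?I"
    by (simp add: vec_eq_iff forall_3 matrix_matrix_mult_def sum_3 mat_def)
  then have "K = det ?J *\<^sub>R ?I"
    by (simp add: matrix_mul_assoc I)
  then have M: "metric_term ?F i j p = K $ i $ j" for i j
    by (simp add: metric_term_def)
  show "metric_term ?F 1 1 p = partial 2 x p * partial 3 y p - partial 3 x p * partial 2 y p"
    "metric_term ?F 1 2 p = 0" "metric_term ?F 1 3 p = 0"
    "metric_term ?F 2 1 p = - partial 1 x p * partial 3 y p + partial 1 y p * partial 3 x p"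
    "metric_term ?F 2 2 p = deriv t (p $ 1) * partial 3 y p"
    "metric_term ?F 2 3 p = - deriv t (p $ 1) * partial 3 x p"
    "metric_term ?F 3 1 p = partial 1 x p * partial 2 y p - partial 1 y p * partial 2 x p"
    "metric_term ?F 3 2 p = - deriv t (p $ 1) * partial 2 y p"
    "metric_term ?F 3 3 p = deriv t (p $ 1) * partial 2 x p"
    by (simp_all add: M K_def J' algebra_simps)
qed

end

theory Submission
  imports Defs
begin

text \<open>
  Let \<open>\<nabla>\<close> denote the gradient in the reference coordinates \<open>(\<tau>, \<xi>, \<eta>)\<close>. The rows of \<open>J\<close> are \<open>\<nabla>t, \<nabla>x, \<nabla>y\<close>,
  so by Cramer's rule the columns of \<open>|J| J\<^sup>-\<^sup>1\<close>, which collect the metric terms belonging to \<open>t\<close>, \<open>x\<close>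
  and \<open>y\<close>, are the cross products \<open>\<nabla>x \<times> \<nabla>y\<close>, \<open>\<nabla>y \<times> \<nabla>t\<close> and \<open>\<nabla>t \<times> \<nabla>x\<close>. The geometric conservation law
  says that each column has divergence zero, and \<open>div (\<nabla>f \<times> \<nabla>g) = 0\<close> whenever second partial
  derivatives commute (\<open>divergence_cross_gradients\<close>). The special entries of the slab metric fit this
  pattern because \<open>\<nabla>t\<close> has only a \<open>\<tau>\<close>-component.

  The discrete law follows since interpolation in a tensor-product polynomial space
  reproduces the members of that space (\<open>tensor_interp_exact\<close>), so that each interpolant agrees
  with the corresponding component of a cross product. This agreement holds only on the reference
  element, which is not open; but a partial derivative only sees a function along a line
  parallel to an axis, and on a nondegenerate interval the derivative is determined by the values on
  the interval, up to and including its end points (\<open>partial_cong_reference_element\<close>). Hence the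
  interpolants may be exchanged for the cross products under the partial derivatives, also on the
  boundary of the element.

  All functions that are differentiated here, the coordinates, their derivatives and the
  interpolants, are finite sums of products of polynomials in one variable; for these, partial
  derivatives are computed factor by factor, which makes their existence and commutation evident.
\<close>

section \<open>Partial derivatives along coordinate lines\<close>

definition coordinate_line :: "3 \<Rightarrow> real^3 \<Rightarrow> real \<Rightarrow> real^3" where
  "coordinate_line k p s = (\<chi> i. if i = k then s else p $ i)"

lemma coordinate_line_at [simp]: "coordinate_line k p (p $ k) = p"
  by (simp add: coordinate_line_def vec_eq_iff)

lemma coordinate_line_nth [simp]: "coordinate_line k p s $ i = (if i = k then s else p $ i)"
  by (simp add: coordinate_line_def)

definition has_partial :: "3 \<Rightarrow> (real^3 \<Rightarrow> real) \<Rightarrow> (real^3 \<Rightarrow> real) \<Rightarrow> bool" where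
  "has_partial k f f' \<longleftrightarrow>
    (\<forall>p. ((\<lambda>s. f (coordinate_line k p s)) has_real_derivative f' p) (at (p $ k)))"

lemma partial_eqI:
  assumes "has_partial k f f'"
  shows "partial k f = f'"
proof
  fix p
  show "partial k f p = f' p"
    using assms unfolding has_partial_def coordinate_line_def partial_def
    by (intro DERIV_imp_deriv) blast
qed

lemma has_partial_diff:
  assumes "has_partial k f f'" "has_partial k g g'"
  shows "has_partial k (\<lambda>p. f p - g p) (\<lambda>p. f' p - g' p)"
  using assms by (auto simp: has_partial_def intro!: DERIV_diff)

lemma has_partial_mult:
  assumes "has_partial k f f'" "has_partial k g g'"
  shows "has_partial k (\<lambda>p. f p * g p) (\<lambda>p. f' p * g p + f p * g' p)"
  unfolding has_partial_def
proof
  fix p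
  have "((\<lambda>s. f (coordinate_line k p s) * g (coordinate_line k p s)) has_real_derivative
      f' p * g (coordinate_line k p (p $ k)) + g' p * f (coordinate_line k p (p $ k))) (at (p $ k))"
    using assms unfolding has_partial_def by (intro DERIV_mult) blast+
  then show "((\<lambda>s. f (coordinate_line k p s) * g (coordinate_line k p s)) has_real_derivative
      f' p * g p + f p * g' p) (at (p $ k))"
    by (simp add: mult.commute)
qed

lemma mem_reference_element: "p \<in> reference_element \<longleftrightarrow> (\<forall>i. p $ i \<in> {-1..1})"
  by (simp add: mem_box_cart)

text \<open>
  Through a point of the closed cube, every coordinate line meets the cube in a copy of \<open>[-1,1]\<close>. Both
  derivatives exist, so they are also one-sided derivatives at \<open>\<plusminus>1\<close>, which are unique.
\<close>

lemma partial_cong_reference_element: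
  assumes f: "has_partial k f f'" and g: "has_partial k g g'"
    and eq: "\<And>p. p \<in> reference_element \<Longrightarrow> f p = g p"
    and p: "p \<in> reference_element"
  shows "partial k f p = partial k g p"
proof -
  let ?z = "p $ k" and ?I = "{-1..1::real}"
  have z: "?z \<in> ?I" using p by (simp add: mem_reference_element del: atLeastAtMost_iff)
  have line: "coordinate_line k p s \<in> reference_element" if "s \<in> ?I" for s
    using p that by (simp add: mem_reference_element)
  have F: "((\<lambda>s. f (coordinate_line k p s)) has_vector_derivative f' p) (at ?z within ?I)"
    and G: "((\<lambda>s. g (coordinate_line k p s)) has_vector_derivative g' p) (at ?z within ?I)"
    using f g unfolding has_partial_def
    by (auto simp: has_real_derivative_iff_has_vector_derivative
        intro: has_vector_derivative_at_within)
  have "((\<lambda>s. f (coordinate_line k p s)) has_vector_derivative g' p) (at ?z within ?I)"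
    using z by (rule has_vector_derivative_transform[OF _ _ G]) (use eq line in auto)
  then have "f' p = g' p"
    using F z by (intro vector_derivative_unique_within_closed_interval[of "-1" 1 ?z]) auto
  then show ?thesis using partial_eqI[OF f] partial_eqI[OF g] by simp
qed

section \<open>Sums of products of univariate polynomials\<close>

definition tensor_sum :: "nat \<Rightarrow> nat \<Rightarrow> nat \<Rightarrow> (nat \<Rightarrow> real poly) \<Rightarrow> (nat \<Rightarrow> real poly) \<Rightarrow>
    (nat \<Rightarrow> real poly) \<Rightarrow> (nat \<Rightarrow> nat \<Rightarrow> nat \<Rightarrow> real) \<Rightarrow> real^3 \<Rightarrow> real" where
  "tensor_sum N M K f g h W p =
    (\<Sum>i\<le>N. \<Sum>j\<le>M. \<Sum>k\<le>K. poly (f i) (p $ 2) * poly (g j) (p $ 3) * poly (h k) (p $ 1) * W i j k)"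

definition tensor_polynomial :: "(real^3 \<Rightarrow> real) \<Rightarrow> bool" where
  "tensor_polynomial F \<longleftrightarrow> (\<exists>N M K f g h W. F = tensor_sum N M K f g h W)"

definition pderiv_if :: "bool \<Rightarrow> (nat \<Rightarrow> real poly) \<Rightarrow> nat \<Rightarrow> real poly" where
  "pderiv_if b f i = (if b then pderiv (f i) else f i)"

text \<open>
  The factors that depend on \<open>\<tau>\<close>, \<open>\<xi>\<close>, \<open>\<eta>\<close> are differentiated independently of each other; in this
  form, iterated partial derivatives commute by the commutation of \<open>pderiv_if\<close> with itself.
\<close>

lemma has_partial_tensor_sum:
  "has_partial l (tensor_sum N M K f g h W)
    (tensor_sum N M K (pderiv_if (l = 2) f) (pderiv_if (l = 3) g) (pderiv_if (l = 1) h) W)"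
proof -
  have "l = 1 \<or> l = 2 \<or> l = 3" by (rule exhaust_3)
  then show ?thesis
    unfolding has_partial_def tensor_sum_def pderiv_if_def
    by (elim disjE) (auto intro!: derivative_eq_intros sum.cong simp: mult_ac)
qed

lemma pderiv_if_commute: "pderiv_if b (pderiv_if c f) = pderiv_if c (pderiv_if b f)"
  by (auto simp: pderiv_if_def fun_eq_iff)

lemma has_partial_tensor_polynomial:
  assumes "tensor_polynomial f"
  shows "has_partial k f (partial k f)"
  using assms has_partial_tensor_sum partial_eqI unfolding tensor_polynomial_def by metis

lemma tensor_polynomial_partial:
  assumes "tensor_polynomial f"
  shows "tensor_polynomial (partial k f)"
  using assms partial_eqI[OF has_partial_tensor_sum] unfolding tensor_polynomial_def by metis

lemma partial_commute_tensor_polynomial: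
  assumes "tensor_polynomial f"
  shows "partial k (partial l f) = partial l (partial k f)"
proof -
  obtain N M K f1 f2 f3 W where f: "f = tensor_sum N M K f1 f2 f3 W"
    using assms unfolding tensor_polynomial_def by blast
  show ?thesis
    unfolding f partial_eqI[OF has_partial_tensor_sum]
    by (simp only: pderiv_if_commute[of "k = _" "l = _"])
qed

lemma tensor_polynomial_differentiable:
  assumes "tensor_polynomial f"
  shows "f differentiable (at p)"
proof -
  obtain N M K f1 f2 f3 W where f: "f = tensor_sum N M K f1 f2 f3 W"
    using assms unfolding tensor_polynomial_def by blast
  have poly_nth: "(\<lambda>p::real^3. poly A (p $ i)) differentiable (at p)" for A i
    by (rule differentiable_compose[where f = "poly A"])
      (auto intro: poly_differentiable
        bounded_linear_imp_differentiable[OF bounded_linear_vec_nth])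
  show ?thesis
    unfolding f tensor_sum_def[abs_def]
    by (intro differentiable_sum differentiable_mult poly_nth ballI) auto
qed

section \<open>Gradients have divergence-free cross products\<close>

definition cross_gradients :: "(real^3 \<Rightarrow> real) \<Rightarrow> (real^3 \<Rightarrow> real) \<Rightarrow> 3 \<Rightarrow> real^3 \<Rightarrow> real" where
  "cross_gradients f g k p =
    partial (k + 1) f p * partial (k + 2) g p - partial (k + 2) f p * partial (k + 1) g p"

text \<open>The index type \<open>3\<close> is cyclic, so \<open>k + 1\<close> and \<open>k + 2\<close> are the other two indices in cyclic order.\<close>

lemma cyclic_successors:
  "(1::3) + 1 = 2" "(1::3) + 2 = 3" "(2::3) + 1 = 3" "(2::3) + 2 = 1" "(3::3) + 1 = 1" "(3::3) + 2 = 2"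
  by simp_all

lemma cross_gradients_components:
  "cross_gradients f g 1 p = partial 2 f p * partial 3 g p - partial 3 f p * partial 2 g p"
  "cross_gradients f g 2 p = partial 3 f p * partial 1 g p - partial 1 f p * partial 3 g p"
  "cross_gradients f g 3 p = partial 1 f p * partial 2 g p - partial 2 f p * partial 1 g p"
  unfolding cross_gradients_def cyclic_successors by (rule refl)+

lemma has_partial_cross_gradients:
  assumes f: "tensor_polynomial f" and g: "tensor_polynomial g"
  shows "has_partial l (cross_gradients f g k)
    (\<lambda>p. (partial l (partial (k + 1) f) p * partial (k + 2) g p
          + partial (k + 1) f p * partial l (partial (k + 2) g) p)
       - (partial l (partial (k + 2) f) p * partial (k + 1) g p
          + partial (k + 2) f p * partial l (partial (k + 1) g) p))"
  unfolding cross_gradients_def[abs_def]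
  by (intro has_partial_diff has_partial_mult has_partial_tensor_polynomial
      tensor_polynomial_partial f g)

lemma divergence_cross_gradients:
  assumes f: "tensor_polynomial f" and g: "tensor_polynomial g"
  shows "partial 1 (cross_gradients f g 1) p + partial 2 (cross_gradients f g 2) p
    + partial 3 (cross_gradients f g 3) p = 0"
proof -
  have comm: "partial 2 (partial 1 h) = partial 1 (partial 2 h)"
    "partial 3 (partial 1 h) = partial 1 (partial 3 h)"
    "partial 3 (partial 2 h) = partial 2 (partial 3 h)"
    if "tensor_polynomial h" for h
    using that by (simp_all only: partial_commute_tensor_polynomial)
  show ?thesis
    unfolding partial_eqI[OF has_partial_cross_gradients[OF f g]] cyclic_successors
    by (simp add: comm[OF f] comm[OF g] algebra_simps)
qed

section \<open>Lagrange interpolation\<close>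

definition lagrange_poly :: "nat \<Rightarrow> (nat \<Rightarrow> real) \<Rightarrow> nat \<Rightarrow> real poly" where
  "lagrange_poly n u i = (\<Prod>j\<in>{..n} - {i}. smult (1 / (u i - u j)) [:- u j, 1:])"

lemma poly_lagrange_poly: "poly (lagrange_poly n u i) z = lagrange_basis n u i z"
  unfolding lagrange_poly_def lagrange_basis_def poly_prod
  by (intro prod.cong) (simp_all add: diff_divide_distrib)

lemma degree_lagrange_poly:
  assumes "i \<le> n"
  shows "degree (lagrange_poly n u i) \<le> n"
proof -
  have "degree (lagrange_poly n u i)
      \<le> (\<Sum>j\<in>{..n} - {i}. degree (smult (1 / (u i - u j)) [:- u j, 1:]))"
    unfolding lagrange_poly_def 
    by (rule order_trans[OF degree_prod_sum_le]) (simp_all only: o_def finite_Diff finite_atMost order_refl)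
  also have "\<dots> \<le> (\<Sum>j\<in>{..n} - {i}. 1)"
    by (rule sum_mono) (simp add: degree_smult_le)
  also have "\<dots> = n" using assms by simp
  finally show ?thesis .
qed

lemma lagrange_basis_node:
  assumes "inj_on u {..n}" "i \<le> n" "k \<le> n"
  shows "lagrange_basis n u i (u k) = (if i = k then 1 else 0)"
proof (cases "i = k")
  case True
  have "u i - u j \<noteq> 0" if "j \<in> {..n} - {i}" for j
    using assms that by (auto simp: inj_on_def)
  then show ?thesis using True by (simp add: lagrange_basis_def)
next
  case False
  then show ?thesis using assms unfolding lagrange_basis_def
    by (auto intro!: prod_zero bexI[of _ k])
qed

text \<open>
  The interpolant and the interpolated polynomial have degree at most \<open>n\<close> and agree at \<open>n + 1\<close>
  distinct nodes.
\<close>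

lemma lagrange_interpolation_exact:
  assumes inj: "inj_on u {..n}" and deg: "degree P \<le> n"
  shows "(\<Sum>i\<le>n. poly P (u i) * lagrange_basis n u i z) = poly P z"
proof -
  define Q where "Q = (\<Sum>i\<le>n. smult (poly P (u i)) (lagrange_poly n u i))"
  have Q: "poly Q w = (\<Sum>i\<le>n. poly P (u i) * lagrange_basis n u i w)" for w
    by (simp add: Q_def poly_sum poly_lagrange_poly)
  have degQ: "degree Q \<le> n"
    unfolding Q_def
    by (intro degree_sum_le)
      (auto intro: order_trans[OF degree_smult_le degree_lagrange_poly] simp del: degree_smult_eq)
  have card: "card (u ` {..n}) = Suc n" using inj by (simp add: card_image)
  have "poly Q w = poly P w" if "w \<in> u ` {..n}" for w
  proof -
    obtain k where k: "k \<le> n" "w = u k" using \<open>w \<in> u ` {..n}\<close> by auto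
    have "poly Q w = (\<Sum>i\<le>n. if i = k then poly P (u i) else 0)"
      unfolding Q k(2) using inj k(1) by (intro sum.cong) (auto simp: lagrange_basis_node)
    then show ?thesis using k by simp
  qed
  then have "Q = P"
    using card deg degQ by (intro poly_eqI_degree[of "u ` {..n}"]) auto
  then show ?thesis using Q by metis
qed

lemma lagrange_interpolation_exact_power_sum:
  assumes "lagrange_nodes n u"
  shows "(\<Sum>i\<le>n. (\<Sum>k\<le>n. \<beta> k * u i ^ k) * lagrange_basis n u i z) = (\<Sum>k\<le>n. \<beta> k * z ^ k)"
proof -
  define P where "P = (\<Sum>k\<le>n. monom (\<beta> k) k)"
  have P: "poly P w = (\<Sum>k\<le>n. \<beta> k * w ^ k)" for w
    by (simp add: P_def poly_sum poly_monom)
  have "degree P \<le> n"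
    unfolding P_def by (intro degree_sum_le) (auto intro: order_trans[OF degree_monom_le])
  then show ?thesis
    using lagrange_interpolation_exact[of u n P z] assms by (simp add: P lagrange_nodes_def)
qed

text \<open>
  Tensor interpolation is interpolation in one variable at a time. Only values at grid points enter the
  interpolant; these lie in the reference element, where \<open>f\<close> is known to be a polynomial.
\<close>

lemma tensor_interp_exact:
  assumes r: "lagrange_nodes a r" and s: "lagrange_nodes b s" and q: "lagrange_nodes c q"
    and f: "f \<in> tensor_poly_space a b c" and p: "p \<in> reference_element"
  shows "tensor_interp a r b s c q f p = f p"
proof -
  obtain \<alpha> where \<alpha>: "\<And>p. p \<in> reference_element \<Longrightarrow>
      f p = (\<Sum>i\<le>a. \<Sum>j\<le>b. \<Sum>k\<le>c. \<alpha> i j k * (p $ 2) ^ i * (p $ 3) ^ j * (p $ 1) ^ k)"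
    using f unfolding tensor_poly_space_def by blast
  define P where "P \<xi> \<eta> \<tau> = (\<Sum>i\<le>a. \<Sum>j\<le>b. \<Sum>k\<le>c. \<alpha> i j k * \<xi> ^ i * \<eta> ^ j * \<tau> ^ k)" for \<xi> \<eta> \<tau>
  let ?\<xi> = "p $ 2" and ?\<eta> = "p $ 3" and ?\<tau> = "p $ 1"
  have grid: "f (vector [q k, r i, s j]) = P (r i) (s j) (q k)" if "i \<le> a" "j \<le> b" "k \<le> c" for i j k
  proof -
    have "vector [q k, r i, s j] \<in> reference_element"
      using r s q that by (auto simp: mem_reference_element forall_3 lagrange_nodes_def image_subset_iff)
    then show ?thesis by (simp add: \<alpha> P_def)
  qed
  have \<tau>: "(\<Sum>k\<le>c. P \<xi> \<eta> (q k) * lagrange_basis c q k ?\<tau>) = P \<xi> \<eta> ?\<tau>" for \<xi> \<eta>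
  proof -
    have "P \<xi> \<eta> \<tau> = (\<Sum>k\<le>c. (\<Sum>i\<le>a. \<Sum>j\<le>b. \<alpha> i j k * \<xi> ^ i * \<eta> ^ j) * \<tau> ^ k)" for \<tau>
      unfolding P_def sum_distrib_right
      by (subst sum.swap[of _ "{..c}"], subst sum.swap[of _ "{..c}"]) simp
    then show ?thesis using lagrange_interpolation_exact_power_sum[OF q] by simp
  qed
  have \<eta>: "(\<Sum>j\<le>b. P \<xi> (s j) ?\<tau> * lagrange_basis b s j ?\<eta>) = P \<xi> ?\<eta> ?\<tau>" for \<xi>
  proof -
    have "P \<xi> \<eta> ?\<tau> = (\<Sum>j\<le>b. (\<Sum>i\<le>a. \<Sum>k\<le>c. \<alpha> i j k * \<xi> ^ i * ?\<tau> ^ k) * \<eta> ^ j)" for \<eta>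
      unfolding P_def sum_distrib_right
      by (subst sum.swap[of _ "{..b}"]) (simp add: mult_ac)
    then show ?thesis using lagrange_interpolation_exact_power_sum[OF s] by simp
  qed
  have \<xi>: "(\<Sum>i\<le>a. P (r i) ?\<eta> ?\<tau> * lagrange_basis a r i ?\<xi>) = P ?\<xi> ?\<eta> ?\<tau>"
  proof -
    have "P \<xi> ?\<eta> ?\<tau> = (\<Sum>i\<le>a. (\<Sum>j\<le>b. \<Sum>k\<le>c. \<alpha> i j k * ?\<eta> ^ j * ?\<tau> ^ k) * \<xi> ^ i)" for \<xi>
      unfolding P_def sum_distrib_right by (simp add: mult_ac)
    then show ?thesis using lagrange_interpolation_exact_power_sum[OF r] by simp
  qed
  have "tensor_interp a r b s c q f p =
      (\<Sum>i\<le>a. (\<Sum>j\<le>b. (\<Sum>k\<le>c. P (r i) (s j) (q k) * lagrange_basis c q k ?\<tau>)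
        * lagrange_basis b s j ?\<eta>) * lagrange_basis a r i ?\<xi>)"
    unfolding tensor_interp_def sum_distrib_right
    by (intro sum.cong) (simp_all add: grid mult_ac)
  also have "\<dots> = f p"
    by (simp add: \<tau> \<eta> \<xi>) (simp add: \<alpha>[OF p] P_def)
  finally show ?thesis .
qed

section \<open>The metric terms and their interpolants\<close>

lemma tensor_polynomial_space_coordinate: "tensor_polynomial (space_coordinate n u m v X)"
proof -
  have "space_coordinate n u m v X =
      tensor_sum n n m (lagrange_poly n u) (lagrange_poly n u) (lagrange_poly m v) X"
    by (simp add: fun_eq_iff space_coordinate_def tensor_sum_def poly_lagrange_poly)
  then show ?thesis unfolding tensor_polynomial_def by blast
qed

lemma tensor_polynomial_time_coordinate: "tensor_polynomial (\<lambda>p. time_coordinate m v T (p $ 1))"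
proof -
  have "(\<lambda>p. time_coordinate m v T (p $ 1)) =
      tensor_sum 0 0 m (\<lambda>_. 1) (\<lambda>_. 1) (lagrange_poly m v) (\<lambda>_ _. T)"
    by (simp add: fun_eq_iff time_coordinate_def tensor_sum_def poly_lagrange_poly)
  then show ?thesis unfolding tensor_polynomial_def by blast
qed

lemma tensor_polynomial_tensor_interp: "tensor_polynomial (tensor_interp a r b s c q f)"
proof -
  have "tensor_interp a r b s c q f =
      tensor_sum a b c (lagrange_poly a r) (lagrange_poly b s) (lagrange_poly c q)
        (\<lambda>i j k. f (vector [q k, r i, s j]))"
    by (simp add: fun_eq_iff tensor_interp_def tensor_sum_def poly_lagrange_poly mult_ac)
  then show ?thesis unfolding tensor_polynomial_def by blast
qed

lemma partial_of_time:
  "partial 1 (\<lambda>p. t (p $ 1)) p = deriv t (p $ 1)"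
  "partial 2 (\<lambda>p. t (p $ 1)) p = 0"
  "partial 3 (\<lambda>p. t (p $ 1)) p = 0"
  by (simp_all add: partial_def)

text \<open>
  This is the cofactor formula for \<open>|J| J\<^sup>-\<^sup>1\<close>, written so that all three physical coordinates play
  the same part.
\<close>

lemma metric_term_eq_cross_gradients:
  fixes x y :: "real^3 \<Rightarrow> real"
  assumes "t differentiable (at (p $ 1))" "x differentiable (at p)" "y differentiable (at p)"
    and "invertible (jacobian (slab_map t x y) (at p))"
  shows "metric_term (slab_map t x y) k 1 p = cross_gradients x y k p"
    and "metric_term (slab_map t x y) k 2 p = cross_gradients y (\<lambda>p. t (p $ 1)) k p"
    and "metric_term (slab_map t x y) k 3 p = cross_gradients (\<lambda>p. t (p $ 1)) x k p"
  using exhaust_3[of k]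
  by (auto simp: metric_term_slab_map[OF assms] cross_gradients_components partial_of_time)

text \<open>
  Inside the divergence, each interpolant may be replaced by the component of the cross product that
  it equals on the reference element.
\<close>

lemma divergence_tensor_interp_eq_0:
  assumes nodes: "lagrange_nodes a r" "lagrange_nodes b s" "lagrange_nodes c q"
    and M: "\<And>k. M k \<in> tensor_poly_space a b c"
    and f: "tensor_polynomial f" and g: "tensor_polynomial g"
    and eq: "\<And>k p. p \<in> reference_element \<Longrightarrow> M k p = cross_gradients f g k p"
    and p: "p \<in> reference_element"
  shows "partial 1 (tensor_interp a r b s c q (M 1)) p
    + partial 2 (tensor_interp a r b s c q (M 2)) p
    + partial 3 (tensor_interp a r b s c q (M 3)) p = 0"
proof -
  have "partial k (tensor_interp a r b s c q (M k)) p = partial k (cross_gradients f g k) p" for k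
    by (rule partial_cong_reference_element[OF
          has_partial_tensor_polynomial[OF tensor_polynomial_tensor_interp]
          has_partial_cross_gradients[OF f g] _ p])
      (simp add: tensor_interp_exact[OF nodes M] eq)
  then show ?thesis by (simp add: divergence_cross_gradients[OF f g])
qed

theorem lemma1:
  fixes n m a b c :: nat
    and u v r s q :: "nat \<Rightarrow> real"
    and T :: "nat \<Rightarrow> real"
    and X Y :: "nat \<Rightarrow> nat \<Rightarrow> nat \<Rightarrow> real"
    and t :: "real \<Rightarrow> real"
    and x y :: "real^3 \<Rightarrow> real"
    and F :: "real^3 \<Rightarrow> real^3"
  assumes "lagrange_nodes n u" and "lagrange_nodes m v"
    and "t = time_coordinate m v T"
    and "x = space_coordinate n u m v X"
    and "y = space_coordinate n u m v Y"
    and "F = slab_map t x y"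
    and "\<forall>p\<in>reference_element. invertible (jacobian F (at p))"
    and "lagrange_nodes a r" and "lagrange_nodes b s" and "lagrange_nodes c q"
    and "\<forall>k j. metric_term F k j \<in> tensor_poly_space a b c"
  shows "\<forall>j. \<forall>p\<in>reference_element.
      partial 1 (tensor_interp a r b s c q (metric_term F 1 j)) p
    + partial 2 (tensor_interp a r b s c q (metric_term F 2 j)) p
    + partial 3 (tensor_interp a r b s c q (metric_term F 3 j)) p = 0"
proof (intro allI ballI)
  fix j :: 3 and p :: "real^3"
  assume p: "p \<in> reference_element"
  have x: "tensor_polynomial x" and y: "tensor_polynomial y" and t: "tensor_polynomial (\<lambda>p. t (p $ 1))"
    using assms(3-5)
    by (simp_all add: tensor_polynomial_space_coordinate tensor_polynomial_time_coordinate)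
  have "t differentiable (at \<tau>)" for \<tau>
  proof -
    \<comment> \<open>The real line is embedded diagonally; only the first component is read.\<close>
    have "(\<lambda>\<tau>. (\<chi> i. \<tau>) :: real^3) differentiable (at \<tau>)"
      by (rule linear_imp_differentiable) (simp add: linear_iff vec_eq_iff)
    from differentiable_chain_at[OF this tensor_polynomial_differentiable[OF t]]
    show ?thesis by (simp add: o_def)
  qed
  then have metric: "metric_term F k 1 w = cross_gradients x y k w"
    "metric_term F k 2 w = cross_gradients y (\<lambda>p. t (p $ 1)) k w"
    "metric_term F k 3 w = cross_gradients (\<lambda>p. t (p $ 1)) x k w"
    if "w \<in> reference_element" for k w
    using that assms(6,7) metric_term_eq_cross_gradients
      tensor_polynomial_differentiable[OF x] tensor_polynomial_differentiable[OF y]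
    by metis+
  have space: "metric_term F k j \<in> tensor_poly_space a b c" for k j
    using assms(11) by blast
  note divergence = divergence_tensor_interp_eq_0[OF assms(8-10), where M = "\<lambda>k. metric_term F k j", OF space]
  from exhaust_3[of j] show "partial 1 (tensor_interp a r b s c q (metric_term F 1 j)) p
    + partial 2 (tensor_interp a r b s c q (metric_term F 2 j)) p
    + partial 3 (tensor_interp a r b s c q (metric_term F 3 j)) p = 0"
  proof (elim disjE)
    assume "j = 1"
    then show ?thesis using divergence[OF x y _ p] metric by simp
  next
    assume "j = 2"
    then show ?thesis using divergence[OF y t _ p] metric by simp
  next
    assume "j = 3"
    then show ?thesis using divergence[OF t x _ p] metric by simp
  qed
qed

end
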